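(* (Two Colour Lemma) Let $\phi$ be a positive automorphism of a free group $F$ with finite basis $a_1,\dots,a_m$ satisfying the conditioning properties (1)–(5) listed in the context. There exists a constant $T_0$, depending only on $\phi$, so that for all positive words $U$ and $V$, if $U$ $\phi$-neuters $V^{-1}$ then it does so in at most $T_0$ steps.
   Context: A word is positive if none of its letters are inverses $a_j^{-1}$; $\phi$ is positive if each reduced word $\phi(a_i)$ is positive. A letter $x$ is constant if $\phi(x)=x$. Suppose $U$ and $V$ are positive words and that for some $k>0$ the only negative exponents occurring in (the reduced word) $\phi^k(UV^{-1})$ are on constant letters. Then $U$ is said to $\phi$-neuter $V^{-1}$ in at most $k$ steps. Supports and strata: for a basis letter $x$, $\mathrm{Supp}(x)$ is the set of letters appearing in $\phi^j(x)$ for some $j\ge0$; $\Sigma(x)=\{y\in\mathrm{Supp}(x):\mathrm{Supp}(y)=\mathrm{Supp}(x)\}$; $x$ is exponential if $\Sigma(x)=\Sigma(y)$ for some $y\neq x$. Conditioning properties assumed of $\phi$ (they hold for a suitable positive power of any positive automorphism): (1) each letter $x$ appears in $\phi(x)$; (2) each exponential letter $x$ appears at least 3 times in $\phi(x)$; (3) for all $x$, each $y\in\mathrm{Supp}(x)$ appears in $\phi(x)$; (4) for all $x$ and $j\ge1$ the leftmost and rightmost letters of $\phi^j(x)$ are the same as those of $\phi(x)$; (5) for all $x$, $j\ge1$ and all strata $\Sigma\subseteq\mathrm{Supp}(x)$, the leftmost (resp. rightmost) letter from $\Sigma$ in $\phi^j(x)$ is the same as the leftmost (resp. rightmost) letter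 from $\Sigma$ in $\phi(x)$. *)

theory Defs
  imports "HOL-Algebra.Group"
begin

section \<open>Free groups as groups of reduced words\<close>

text \<open>A signed letter \<open>(x, True)\<close> stands for the basis element \<open>x\<close>, and \<open>(x, False)\<close> for its
  inverse.  The basis of the free group is the type \<open>'a\<close>.\<close>

type_synonym 'a word = "('a \<times> bool) list"

definition flip :: "'a \<times> bool \<Rightarrow> 'a \<times> bool" where
  "flip l = (fst l, \<not> snd l)"

definition reduced :: "'a word \<Rightarrow> bool" where
  "reduced w \<longleftrightarrow> successively (\<lambda>k l. l \<noteq> flip k) w"

fun push :: "'a \<times> bool \<Rightarrow> 'a word \<Rightarrow> 'a word" where
  "push l [] = [l]"
| "push l (k # w) = (if k = flip l then w else l # k # w)"

definition reduce :: "'a word \<Rightarrow> 'a word" where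
  "reduce w = foldr push w []"

definition free_group :: "'a word monoid" where
  "free_group = \<lparr>carrier = {w. reduced w}, mult = (\<lambda>u v. reduce (u @ v)), one = []\<rparr>"

definition gen :: "'a \<Rightarrow> 'a word" where
  "gen x = [(x, True)]"

definition letters :: "'a word \<Rightarrow> 'a set" where
  "letters w = fst ` set w"

lemma flip_flip [simp]: "flip (flip l) = l"
  by (simp add: flip_def)

lemma reduced_push: "reduced w \<Longrightarrow> reduced (push l w)"
  by (cases w) (auto simp: reduced_def successively_Cons)

lemma reduced_reduce: "reduced (reduce w)"
  unfolding reduce_def by (induction w) (simp_all add: reduced_push, simp add: reduced_def)

lemma reduce_reduced: "reduced w \<Longrightarrow> reduce w = w"
proof (induction w)
  case (Cons l w)
  then have "reduce w = w"
    by (auto simp: reduced_def successively_Cons)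
  with Cons.prems show ?case
    by (cases w) (auto simp: reduced_def reduce_def)
qed (simp add: reduce_def)

lemma push_flip: "reduced w \<Longrightarrow> push l (push (flip l) w) = w"
proof (cases w)
  case (Cons k v)
  assume "reduced w"
  with Cons show ?thesis
    by (cases v) (auto simp: reduced_def)
qed simp

lemma reduced_foldr_push: "reduced v \<Longrightarrow> reduced (foldr push u v)"
  by (induction u) (simp_all add: reduced_push)

lemma foldr_push_push:
  assumes "reduced v"
  shows "foldr push (push l u) v = push l (foldr push u v)"
proof (cases u)
  case (Cons k w)
  then show ?thesis
    using push_flip[OF reduced_foldr_push[OF assms], of l w] by auto
qed simp

lemma foldr_push_reduce:
  assumes "reduced v"
  shows "foldr push (reduce u) v = foldr push u v"
  by (induction u) (simp_all add: reduce_def foldr_push_push[OF assms])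

lemma reduce_append_right: "reduce (u @ reduce v) = reduce (u @ v)"
  using reduce_reduced[OF reduced_reduce, of v] by (simp add: reduce_def)

lemma reduce_append_left: "reduce (reduce u @ v) = reduce (u @ v)"
  using foldr_push_reduce[OF reduced_reduce, of u v] by (simp add: reduce_def)

lemma reduce_inverse: "reduce (rev (map flip w) @ w) = []"
proof (induction w)
  case (Cons l w)
  have "push (flip l) (push l (reduce w)) = reduce w"
    using push_flip[OF reduced_reduce, of "flip l" w] by simp
  with Cons show ?case
    by (simp add: reduce_def)
qed (simp add: reduce_def)

lemma group_free_group: "group free_group"
proof (rule groupI)
  fix u :: "'a word"
  show "\<exists>v\<in>carrier free_group. v \<otimes>\<^bsub>free_group\<^esub> u = \<one>\<^bsub>free_group\<^esub>"
    by (rule bexI[of _ "reduce (rev (map flip u))"])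
      (simp_all add: free_group_def reduced_reduce reduce_append_left reduce_inverse)
qed (simp_all add: free_group_def reduced_reduce reduce_append_left reduce_append_right
    reduce_reduced reduced_def[of "[]"])


section \<open>Positive endomorphisms\<close>

definition positive_word :: "'a word \<Rightarrow> bool" where
  "positive_word w \<longleftrightarrow> (\<forall>l\<in>set w. snd l)"

definition positive :: "('a word \<Rightarrow> 'a word) \<Rightarrow> bool" where
  "positive \<phi> \<longleftrightarrow> (\<forall>x. positive_word (\<phi> (gen x)))"

lemma positive_word_in_free_group: "positive_word w \<Longrightarrow> w \<in> carrier free_group"
proof (induction w)
  case (Cons l w)
  then show ?case
    by (cases w) (auto simp: positive_word_def free_group_def reduced_def flip_def)
qed (simp add: free_group_def reduced_def)

definition constant_letter :: "('a word \<Rightarrow> 'a word) \<Rightarrow> 'a \<Rightarrow> bool" where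
  "constant_letter \<phi> x \<longleftrightarrow> \<phi> (gen x) = gen x"

definition Supp :: "('a word \<Rightarrow> 'a word) \<Rightarrow> 'a \<Rightarrow> 'a set" where
  "Supp \<phi> x = (\<Union>j. letters ((\<phi> ^^ j) (gen x)))"

definition stratum :: "('a word \<Rightarrow> 'a word) \<Rightarrow> 'a \<Rightarrow> 'a set" where
  "stratum \<phi> x = {y \<in> Supp \<phi> x. Supp \<phi> y = Supp \<phi> x}"

definition exponential :: "('a word \<Rightarrow> 'a word) \<Rightarrow> 'a \<Rightarrow> bool" where
  "exponential \<phi> x \<longleftrightarrow> (\<exists>y. y \<noteq> x \<and> stratum \<phi> x = stratum \<phi> y)"

definition leftmost_in :: "'a set \<Rightarrow> 'a word \<Rightarrow> ('a \<times> bool) option" where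
  "leftmost_in S w = find (\<lambda>l. fst l \<in> S) w"

definition rightmost_in :: "'a set \<Rightarrow> 'a word \<Rightarrow> ('a \<times> bool) option" where
  "rightmost_in S w = find (\<lambda>l. fst l \<in> S) (rev w)"

definition conditioned :: "('a word \<Rightarrow> 'a word) \<Rightarrow> bool" where
  "conditioned \<phi> \<longleftrightarrow>
     (\<forall>x. x \<in> letters (\<phi> (gen x))) \<and>
     (\<forall>x. exponential \<phi> x \<longrightarrow> 3 \<le> count_list (map fst (\<phi> (gen x))) x) \<and>
     (\<forall>x. \<forall>y\<in>Supp \<phi> x. y \<in> letters (\<phi> (gen x))) \<and>
     (\<forall>x. \<forall>j\<ge>1. hd ((\<phi> ^^ j) (gen x)) = hd (\<phi> (gen x)) \<and>
                last ((\<phi> ^^ j) (gen x)) = last (\<phi> (gen x))) \<and>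
     (\<forall>x. \<forall>j\<ge>1. \<forall>S\<in>range (stratum \<phi>). S \<subseteq> Supp \<phi> x \<longrightarrow>
        leftmost_in S ((\<phi> ^^ j) (gen x)) = leftmost_in S (\<phi> (gen x)) \<and>
        rightmost_in S ((\<phi> ^^ j) (gen x)) = rightmost_in S (\<phi> (gen x)))"

text \<open>\<open>neuters_within \<phi> U V k\<close> says that \<open>U\<close> \<open>\<phi>\<close>-neuters the inverse of \<open>V\<close> in at most \<open>k\<close>
  steps.\<close>

definition neuters_within ::
  "('a word \<Rightarrow> 'a word) \<Rightarrow> 'a word \<Rightarrow> 'a word \<Rightarrow> nat \<Rightarrow> bool" where
  "neuters_within \<phi> U V k \<longleftrightarrow> k > 0 \<and>
     (\<forall>x. (x, False) \<in> set ((\<phi> ^^ k) (U \<otimes>\<^bsub>free_group\<^esub> inv\<^bsub>free_group\<^esub> V)) \<longrightarrow> constant_letter \<phi> x)"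

definition neuters :: "('a word \<Rightarrow> 'a word) \<Rightarrow> 'a word \<Rightarrow> 'a word \<Rightarrow> bool" where
  "neuters \<phi> U V \<longleftrightarrow> (\<exists>k. neuters_within \<phi> U V k)"

end

theory Submission
  imports Defs "HOL-Library.Sublist"
begin

text \<open>Read backwards, \<open>U\<close> neuters the inverse of \<open>V\<close> after \<open>k\<close> steps if \<open>\<phi>\<^sup>k(V)\<close> is a common prefix
  with \<open>\<phi>\<^sup>k(U)\<close> followed by constant letters.  Let \<open>v\<close> be a nonconstant letter of \<open>V\<close> with a maximal
  support, let \<open>\<Sigma>\<close> be its stratum, and delete from all words the letters whose support does not
  contain \<open>v\<close>.  If the shortened \<open>\<phi>\<^sup>s(V)\<close> is a prefix of the shortened \<open>\<phi>\<^sup>s(U)\<close>, and the letters of \<open>\<Sigma>\<close>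
  are cancelled eventually, then injectivity of \<open>\<phi>\<close> forces the deleted letters in between to agree
  as well, so that \<open>\<Sigma>\<close> is already cancelled at time \<open>s\<close>.  Hence the cancellation time of \<open>\<Sigma>\<close> is
  bounded as soon as the number of letters of \<open>\<Sigma>\<close> in \<open>V\<close> is, since finitely many shortened pairs
  are left.

  If the image of each letter of \<open>\<Sigma>\<close> contains two letters of \<open>\<Sigma>\<close>, that number is bounded by the
  bounded cancellation constant: a larger number would more than survive every step.  Otherwise
  \<open>\<Sigma> = {v}\<close> and \<open>\<phi>(v)\<close> contains \<open>v\<close> once.  After \<open>t\<close> steps, consecutive occurrences of \<open>v\<close> are at
  distance at least \<open>t\<close> in the remainder of \<open>\<phi>\<^sup>t(V)\<close>, but if there are two of them, they must be matched
  by two occurrences at bounded distance, in the image of a single letter of the remainder of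
  \<open>\<phi>\<^sup>t(U)\<close>.  So at most one is left after a bounded time.

  Induction on the set of letters of \<open>V\<close> removes one stratum after the other.\<close>

section \<open>Substitutions\<close>

definition extend :: "('a \<Rightarrow> 'b list) \<Rightarrow> 'a list \<Rightarrow> 'b list" where
  "extend h w = concat (map h w)"

lemma extend_Nil [simp]: "extend h [] = []"
  and extend_Cons: "extend h (x # w) = h x @ extend h w"
  and extend_append [simp]: "extend h (u @ w) = extend h u @ extend h w"
  and set_extend: "set (extend h w) = (\<Union>x\<in>set w. set (h x))"
  by (auto simp: extend_def)

lemma funpow_extend_append [simp]:
  fixes h :: "'a \<Rightarrow> 'a list"
  shows "(extend h ^^ k) (u @ w) = (extend h ^^ k) u @ (extend h ^^ k) w"
  by (induction k) simp_all

lemma funpow_extend_Cons: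
  fixes h :: "'a \<Rightarrow> 'a list"
  shows "(extend h ^^ k) (x # w) = (extend h ^^ k) [x] @ (extend h ^^ k) w"
  using funpow_extend_append[of k h "[x]" w] by simp

lemma funpow_extend_Nil [simp]:
  fixes h :: "'a \<Rightarrow> 'a list"
  shows "(extend h ^^ k) [] = []"
  by (induction k) simp_all

lemma length_funpow_extend:
  fixes h :: "'a \<Rightarrow> 'a list"
  shows "length ((extend h ^^ k) w) = (\<Sum>x\<leftarrow>w. length ((extend h ^^ k) [x]))"
proof (induction w)
  case (Cons x w)
  then show ?case
    by (simp add: funpow_extend_Cons[of k h x w])
qed simp

lemma prefix_funpow_extend:
  fixes h :: "'a \<Rightarrow> 'a list"
  shows "prefix u w \<Longrightarrow> prefix ((extend h ^^ k) u) ((extend h ^^ k) w)"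
  by (auto simp: prefix_def)

definition diverge :: "'a list \<Rightarrow> 'a list \<Rightarrow> bool" where
  "diverge u w \<longleftrightarrow> u = [] \<or> w = [] \<or> hd u \<noteq> hd w"

lemma diverge_decomposition:
  obtains c u' w' where "u = c @ u'" "w = c @ w'" "diverge u' w'"
proof -
  have "\<exists>c u' w'. u = c @ u' \<and> w = c @ w' \<and> diverge u' w'"
  proof (induction u arbitrary: w)
    case Nil
    show ?case by (auto simp: diverge_def)
  next
    case (Cons x u)
    show ?case
    proof (cases "w \<noteq> [] \<and> hd w = x")
      case True
      then obtain w1 where w: "w = x # w1" by (cases w) auto
      obtain c u' w' where "u = c @ u'" "w1 = c @ w'" "diverge u' w'"
        using Cons.IH[of w1] by blast
      then show ?thesis
        using w by (intro exI[of _ "x # c"] exI[of _ u'] exI[of _ w']) auto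
    next
      case False
      then show ?thesis
        by (intro exI[of _ "[]"] exI[of _ "x # u"] exI[of _ w]) (auto simp: diverge_def)
    qed
  qed
  then show thesis
    using that by blast
qed

lemma split_first:
  assumes "filter P w = x # ys"
  obtains a b where "w = a @ x # b" "filter P a = []" "P x" "filter P b = ys"
  using assms that by (force simp: filter_eq_Cons_iff filter_empty_conv)

section \<open>Clearing letters by cancellation\<close>

locale substitution =
  fixes h :: "'a::finite \<Rightarrow> 'a list"
  assumes self: "x \<in> set (h x)"
    and trans: "y \<in> set (h x) \<Longrightarrow> z \<in> set (h y) \<Longrightarrow> z \<in> set (h x)"
    and inj: "inj (extend h)"
    and bounded_cancellation:
      "\<exists>B. \<forall>u w c. diverge u w \<longrightarrow> prefix c (extend h u) \<longrightarrow> prefix c (extend h w) \<longrightarrow> length c \<le> B"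
begin

abbreviation "f \<equiv> extend h"

definition cleared :: "'a set \<Rightarrow> nat \<Rightarrow> 'a list \<Rightarrow> 'a list \<Rightarrow> bool" where
  "cleared D k u w \<longleftrightarrow>
     (\<exists>c p q. (f ^^ k) u = c @ p \<and> (f ^^ k) w = c @ q \<and> set q \<inter> D = {})"

lemma clearedI:
  "(f ^^ k) u = c @ p \<Longrightarrow> (f ^^ k) w = c @ q \<Longrightarrow> set q \<inter> D = {} \<Longrightarrow> cleared D k u w"
  by (auto simp: cleared_def)

lemma cleared_trivial: "set ((f ^^ k) w) \<inter> D = {} \<Longrightarrow> cleared D k u w"
  by (rule clearedI[of _ _ "[]"]) simp_all

definition inert :: "'a set \<Rightarrow> bool" where
  "inert D \<longleftrightarrow> (\<forall>x. x \<notin> D \<longrightarrow> set (h x) \<inter> D = {})"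

lemma set_subset_extend: "set w \<subseteq> set (f w)"
  using self by (auto simp: set_extend)

lemma set_subset_funpow: "set w \<subseteq> set ((f ^^ k) w)"
  by (induction k) (use set_subset_extend in auto)

lemma length_extend_ge: "length w \<le> length (f w)"
proof (induction w)
  case (Cons x w)
  have "h x \<noteq> []" using self[of x] by auto
  with Cons show ?case
    by (cases "h x") (simp_all add: extend_Cons)
qed simp

lemma inj_funpow: "inj (f ^^ k)"
  using inj by (rule inj_fn)

lemma inert_extend: "inert D \<Longrightarrow> set w \<inter> D = {} \<Longrightarrow> set (f w) \<inter> D = {}"
  by (fastforce simp: inert_def set_extend)

lemma inert_funpow: "inert D \<Longrightarrow> set w \<inter> D = {} \<Longrightarrow> set ((f ^^ k) w) \<inter> D = {}"
  by (induction k) (simp_all add: inert_extend)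

lemma cleared_add: "cleared D (j + k) u w \<longleftrightarrow> cleared D j ((f ^^ k) u) ((f ^^ k) w)"
  by (simp add: cleared_def funpow_add)

lemma cleared_mono:
  assumes "inert D" "cleared D k u w" "k \<le> l"
  shows "cleared D l u w"
proof -
  obtain j where l: "l = j + k"
    using assms(3) by (metis add.commute le_Suc_ex)
  obtain c p q where "(f ^^ k) u = c @ p" "(f ^^ k) w = c @ q" "set q \<inter> D = {}"
    using assms(2) by (auto simp: cleared_def)
  then show ?thesis
    unfolding l cleared_add using inert_funpow[OF assms(1), of q j]
    by (intro clearedI[of _ _ "(f ^^ j) c" "(f ^^ j) p" _ "(f ^^ j) q"]) simp_all
qed

lemma cleared_cancel: "cleared D k (c @ u) (c @ w) \<longleftrightarrow> cleared D k u w"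
proof
  assume "cleared D k (c @ u) (c @ w)"
  then obtain d p q where *: "(f ^^ k) c @ (f ^^ k) u = d @ p"
    "(f ^^ k) c @ (f ^^ k) w = d @ q" "set q \<inter> D = {}"
    by (auto simp: cleared_def)
  from *(2) consider r where "d = (f ^^ k) c @ r" "(f ^^ k) w = r @ q"
    | r where "q = r @ (f ^^ k) w"
    by (auto simp: append_eq_append_conv2)
  then show "cleared D k u w"
  proof cases
    case 1
    then show ?thesis using * by (intro clearedI[of _ _ r p _ q]) simp_all
  next
    case 2
    then show ?thesis using *(3) by (intro cleared_trivial) auto
  qed
next
  assume "cleared D k u w"
  then obtain d p q where "(f ^^ k) u = d @ p" "(f ^^ k) w = d @ q" "set q \<inter> D = {}"
    by (auto simp: cleared_def)
  then show "cleared D k (c @ u) (c @ w)"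
    by (intro clearedI[of _ _ "(f ^^ k) c @ d" p _ q]) simp_all
qed

lemma cleared_appendD:
  assumes "cleared D k u (w @ w')"
  shows "cleared D k u w"
proof -
  obtain c p q where *: "(f ^^ k) u = c @ p"
    "(f ^^ k) w @ (f ^^ k) w' = c @ q" "set q \<inter> D = {}"
    using assms by (auto simp: cleared_def)
  from *(2) consider r where "c = (f ^^ k) w @ r"
    | r where "(f ^^ k) w = c @ r" "q = r @ (f ^^ k) w'"
    by (auto simp: append_eq_append_conv2)
  then show ?thesis
    using * by cases (auto simp: cleared_def)
qed

text \<open>The first letter of \<open>D\<close> in \<open>f\<^sup>k w\<close> is matched with the first letter of \<open>D\<close> in \<open>f\<^sup>k u\<close>, so the
  images of the parts of \<open>w\<close> and \<open>u\<close> before their first letter of \<open>D\<close> agree; by injectivity these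
  parts agree themselves.\<close>

lemma sync:
  assumes "inert D" "cleared D k u w"
    and "prefix (filter (\<lambda>x. x \<in> D) w) (filter (\<lambda>x. x \<in> D) u)"
  shows "cleared D 0 u w"
  using assms(2,3)
proof (induction "length w" arbitrary: u w rule: less_induct)
  case less
  let ?F = "filter (\<lambda>x. x \<in> D)"
  show ?case
  proof (cases "?F w")
    case Nil
    then show ?thesis
      by (intro cleared_trivial) (auto simp: filter_empty_conv)
  next
    case (Cons x ys)
    then obtain zs where u: "?F u = x # zs" and pre: "prefix ys zs"
      using less.prems(2) by (cases "?F u") auto
    obtain a w' where w: "w = a @ x # w'" "?F a = []" "x \<in> D" "?F w' = ys"
      using Cons by (rule split_first)
    obtain b u' where u: "u = b @ x # u'" "?F b = []" "?F u' = zs"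
      using u by (rule split_first)
    have a: "set ((f ^^ k) a) \<inter> D = {}" and b: "set ((f ^^ k) b) \<inter> D = {}"
      using w(2) u(2) by (auto intro!: inert_funpow[OF assms(1)] simp: filter_empty_conv)
    have x: "x \<in> set ((f ^^ k) [x])"
      using set_subset_funpow[of "[x]" k] by simp
    obtain c p q where c: "(f ^^ k) u = c @ p" "(f ^^ k) w = c @ q" "set q \<inter> D = {}"
      using less.prems(1) by (auto simp: cleared_def)
    let ?T = "takeWhile (\<lambda>x. x \<notin> D)"
    have fx: "(f ^^ k) (d @ x # e) = (f ^^ k) d @ (f ^^ k) [x] @ (f ^^ k) e" for d e
      by (simp add: funpow_extend_Cons[of k h x e])
    have T: "?T ((f ^^ k) (d @ x # e)) = (f ^^ k) d @ ?T ((f ^^ k) [x])"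
      if "set ((f ^^ k) d) \<inter> D = {}" for d e
    proof -
      have "?T ((f ^^ k) d @ (f ^^ k) [x] @ (f ^^ k) e) = (f ^^ k) d @ ?T ((f ^^ k) [x] @ (f ^^ k) e)"
        using that by (subst takeWhile_append2) auto
      then show ?thesis
        unfolding fx using x w(3) by (subst (asm) takeWhile_append1[of x]) auto
    qed
    have "set c \<inter> D \<noteq> {}"
    proof -
      have "x \<in> set ((f ^^ k) w)"
        unfolding w(1) fx using x by simp
      then show ?thesis using c w(3) by auto
    qed
    then obtain y where "y \<in> set c" "y \<in> D" by auto
    then have "?T (c @ r) = ?T c" for r
      by (intro takeWhile_append1[of y]) auto
    then have "?T ((f ^^ k) u) = ?T ((f ^^ k) w)"
      using c by simp
    then have "(f ^^ k) a = (f ^^ k) b"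
      unfolding w(1) u(1) T[OF a] T[OF b] by simp
    then have ab: "a = b"
      using inj_funpow by (auto dest: injD)
    have "cleared D k u' w'"
      using less.prems(1) cleared_cancel[of D k "a @ [x]" u' w'] unfolding w(1) u(1) ab by simp
    moreover have "prefix (?F w') (?F u')"
      using pre u w by simp
    ultimately have "cleared D 0 u' w'"
      using less.hyps[of w' u'] w(1) by simp
    then show ?thesis
      using cleared_cancel[of D 0 "a @ [x]" u' w'] unfolding w(1) u(1) ab by simp
  qed
qed

section \<open>A single class of letters\<close>

definition above :: "'a \<Rightarrow> 'a set" where
  "above v = {x. v \<in> set (h x)}"

definition tame :: "'a \<Rightarrow> 'a list \<Rightarrow> bool" where
  "tame v w \<longleftrightarrow> set w \<inter> above v \<subseteq> set (h v)"

abbreviation proj :: "'a \<Rightarrow> 'a list \<Rightarrow> 'a list" where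
  "proj v \<equiv> filter (\<lambda>x. x \<in> above v)"

lemma inert_above: "inert (above v)"
  unfolding inert_def above_def using trans by blast

lemma tame_extend: "tame v w \<Longrightarrow> tame v (f w)"
  unfolding tame_def above_def set_extend using trans by blast

lemma tame_funpow: "tame v w \<Longrightarrow> tame v ((f ^^ k) w)"
  by (induction k) (simp_all add: tame_extend)

lemma tame_append: "tame v (u @ w) \<longleftrightarrow> tame v u \<and> tame v w"
  by (auto simp: tame_def)

lemma proj_extend: "proj v (f w) = extend (\<lambda>x. proj v (h x)) (proj v w)"
proof (induction w)
  case (Cons x w)
  have "x \<notin> above v \<Longrightarrow> proj v (h x) = []"
    using inert_above[of v] by (auto simp: inert_def filter_empty_conv)
  with Cons show ?case by (simp add: extend_Cons)
qed simp

lemma proj_funpow: "proj v ((f ^^ k) w) = (extend (\<lambda>x. proj v (h x)) ^^ k) (proj v w)"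
  by (induction k) (simp_all add: proj_extend)

lemma cleared_prefix:
  assumes "cleared (above v) k u w"
  shows "prefix (proj v ((f ^^ k) w)) (proj v ((f ^^ k) u))"
proof -
  obtain c p q where "(f ^^ k) u = c @ p" "(f ^^ k) w = c @ q" "set q \<inter> above v = {}"
    using assms by (auto simp: cleared_def)
  moreover from this have "proj v q = []"
    by (auto simp: filter_empty_conv)
  ultimately show ?thesis by simp
qed

lemma length_image_bound: obtains K where "K > 0" "\<And>x. length (h x) \<le> K"
proof
  show "length (h x) \<le> Suc (Max (range (\<lambda>x. length (h x))))" for x
    by (rule le_SucI, rule Max_ge) auto
qed simp

text \<open>Only boundedly many letters of \<open>proj v u\<close> can matter, because every letter above \<open>v\<close> grows
  at least as fast, up to a constant factor, as the letters in the class of \<open>v\<close>.  So finitely many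
  pairs of projected words have to be considered, and \<open>sync\<close> returns to the words themselves.\<close>

lemma cleared_uniform_of_bounded:
  obtains S where "\<And>u w k. tame v w \<Longrightarrow> length (proj v w) \<le> N \<Longrightarrow> cleared (above v) k u w \<Longrightarrow>
    cleared (above v) S u w"
proof -
  obtain K where K: "K > 0" "\<And>x. length (h x) \<le> K"
    using length_image_bound by blast
  let ?g = "\<lambda>x. proj v (h x)"
  let ?G = "extend ?g"
  let ?l = "\<lambda>k x. length ((?G ^^ k) [x])"
  have class_le: "?l k y \<le> K * ?l k x" if "y \<in> set (h v)" "y \<in> above v" "x \<in> above v" for k x y
  proof (cases k)
    case 0
    then show ?thesis using K(1) by simp
  next
    case (Suc j)
    have step: "?l k x = length ((?G ^^ j) (?g x))" for x
      unfolding Suc funpow_Suc_right by (simp add: extend_def)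
    have "?l j z \<le> ?l k x" if z: "z \<in> set (?g y)" for z
    proof -
      have "z \<in> set (h v)" "z \<in> above v"
        using z \<open>y \<in> set (h v)\<close> trans by auto
      then have "z \<in> set (?g x)"
        using \<open>x \<in> above v\<close> trans[of v x z] by (simp add: above_def)
      then obtain a b where "?g x = a @ [z] @ b"
        by (metis append_Cons append_Nil in_set_conv_decomp)
      then show ?thesis
        unfolding step by (simp del: append_Cons)
    qed
    then have "(\<Sum>z\<leftarrow>?g y. ?l j z) \<le> (\<Sum>z\<leftarrow>?g y. ?l k x)"
      by (intro sum_list_mono) auto
    also have "\<dots> \<le> K * ?l k x"
      using le_trans[OF length_filter_le K(2)] by (simp add: sum_list_triv)
    also have "(\<Sum>z\<leftarrow>?g y. ?l j z) = ?l k y"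
      unfolding step by (rule length_funpow_extend[symmetric])
    finally show ?thesis .
  qed
  define M where "M = N * K"
  have truncate: "prefix ((?G ^^ k) ys) ((?G ^^ k) (take M xs))"
    if ys: "set ys \<subseteq> set (h v) \<inter> above v" "length ys \<le> N" and xs: "set xs \<subseteq> above v"
      and pre: "prefix ((?G ^^ k) ys) ((?G ^^ k) xs)" for xs ys k
  proof (cases "length xs \<le> M")
    case True
    then show ?thesis using pre by simp
  next
    case False
    define L where "L = Min (?l k ` above v)"
    have v: "v \<in> above v" using self by (simp add: above_def)
    have L: "L \<le> ?l k x" if "x \<in> above v" for x
      unfolding L_def using that by (intro Min_le) auto
    have "L \<in> ?l k ` above v"
      unfolding L_def using v by (intro Min_in) auto
    then obtain x0 where x0: "x0 \<in> above v" "L = ?l k x0" by auto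
    have "length ((?G ^^ k) ys) = (\<Sum>y\<leftarrow>ys. ?l k y)"
      by (rule length_funpow_extend)
    also have "\<dots> \<le> (\<Sum>y\<leftarrow>ys. K * L)"
      unfolding x0(2) using ys(1) x0(1) by (intro sum_list_mono class_le) auto
    also have "\<dots> \<le> M * L"
      using ys(2) by (simp add: sum_list_triv M_def)
    also have "\<dots> = (\<Sum>x\<leftarrow>take M xs. L)"
      using False by (simp add: sum_list_triv min_def)
    also have "\<dots> \<le> (\<Sum>x\<leftarrow>take M xs. ?l k x)"
      using L xs by (intro sum_list_mono) (auto dest: in_set_takeD)
    also have "\<dots> = length ((?G ^^ k) (take M xs))"
      by (rule length_funpow_extend[symmetric])
    finally have "length ((?G ^^ k) ys) \<le> length ((?G ^^ k) (take M xs))" .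
    moreover have "prefix ((?G ^^ k) (take M xs)) ((?G ^^ k) xs)"
      by (intro prefix_funpow_extend take_is_prefix)
    ultimately show ?thesis
      using pre prefix_length_prefix by blast
  qed
  define A where "A = {xs :: 'a list. set xs \<subseteq> UNIV \<and> length xs \<le> M} \<times>
    {ys :: 'a list. set ys \<subseteq> UNIV \<and> length ys \<le> N}"
  have "finite A"
    unfolding A_def by (intro finite_cartesian_product finite_lists_length_le) auto
  define s where "s p = (LEAST k. prefix ((?G ^^ k) (snd p)) ((?G ^^ k) (fst p)))" for p
  define S where "S = Max (s ` A)"
  have "cleared (above v) S u w"
    if w: "tame v w" "length (proj v w) \<le> N" and cl: "cleared (above v) k u w" for u w k
  proof -
    let ?p = "(take M (proj v u), proj v w)"
    have "prefix ((?G ^^ k) (proj v w)) ((?G ^^ k) (proj v u))"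
      using cleared_prefix[OF cl] by (simp add: proj_funpow)
    then have "prefix ((?G ^^ k) (snd ?p)) ((?G ^^ k) (fst ?p))"
      using w by (auto intro!: truncate simp: tame_def)
    then have "prefix ((?G ^^ s ?p) (snd ?p)) ((?G ^^ s ?p) (fst ?p))"
      unfolding s_def by (rule LeastI)
    moreover have "?p \<in> A"
      using w(2) by (simp add: A_def)
    then have "s ?p \<le> S"
      unfolding S_def using \<open>finite A\<close> by (intro Max_ge) auto
    then obtain j where "S = j + s ?p"
      by (metis add.commute le_Suc_ex)
    ultimately have "prefix ((?G ^^ S) (proj v w)) ((?G ^^ S) (take M (proj v u)))"
      by (simp add: funpow_add prefix_funpow_extend)
    also have "prefix \<dots> ((?G ^^ S) (proj v u))"
      by (intro prefix_funpow_extend take_is_prefix)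
    finally have "prefix (proj v ((f ^^ S) w)) (proj v ((f ^^ S) u))"
      by (simp add: proj_funpow)
    moreover have "cleared (above v) k ((f ^^ S) u) ((f ^^ S) w)"
      using cleared_mono[OF inert_above cl, of "k + S"] by (simp add: cleared_add)
    ultimately have "cleared (above v) 0 ((f ^^ S) u) ((f ^^ S) w)"
      using sync[OF inert_above] by blast
    then show ?thesis
      using cleared_add[of _ 0 S] by simp
  qed
  then show thesis using that by blast
qed

lemma expanding_bound:
  assumes exp: "\<And>y. y \<in> set (h v) \<Longrightarrow> y \<in> above v \<Longrightarrow> 2 \<le> length (proj v (h y))"
  obtains B where "\<And>u w k. diverge u w \<Longrightarrow> tame v w \<Longrightarrow> cleared (above v) k u w \<Longrightarrow>
    length (proj v w) \<le> B"
proof -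
  obtain B where B: "\<And>u w c. diverge u w \<Longrightarrow> prefix c (f u) \<Longrightarrow> prefix c (f w) \<Longrightarrow> length c \<le> B"
    using bounded_cancellation by blast
  have double: "2 * length (proj v w) \<le> length (proj v (f w))" if "tame v w" for w
    using that
  proof (induction w)
    case (Cons x w)
    then show ?case
      using exp[of x] by (auto simp: tame_def extend_Cons)
  qed simp
  have "length (proj v w) \<le> B"
    if "diverge u w" "tame v w" "cleared (above v) k u w" for u w k
    using that
  proof (induction k arbitrary: u w)
    case 0
    then obtain c p q where c: "u = c @ p" "w = c @ q" "set q \<inter> above v = {}"
      by (auto simp: cleared_def)
    then have "c = []"
      using 0(1) by (cases c) (auto simp: diverge_def)
    then have "proj v w = []"
      using c by (auto simp: filter_empty_conv)
    then show ?case by simp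
  next
    case (Suc k)
    obtain c u' w' where c: "f u = c @ u'" "f w = c @ w'" "diverge u' w'"
      by (rule diverge_decomposition)
    have "length c \<le> B"
      using B[OF Suc.prems(1)] c by simp
    have "cleared (above v) k (f u) (f w)"
      using Suc.prems(3) cleared_add[of _ k 1] by simp
    then have "cleared (above v) k u' w'"
      unfolding c cleared_cancel .
    moreover have "tame v w'"
      using tame_extend[OF Suc.prems(2)] c by (simp add: tame_append)
    ultimately have "length (proj v w') \<le> B"
      using Suc.IH c(3) by blast
    then have "length (proj v (f w)) \<le> 2 * B"
      using \<open>length c \<le> B\<close> le_trans[OF length_filter_le[of "\<lambda>x. x \<in> above v" c], of B] c
      by simp
    then show ?case
      using double[OF Suc.prems(2)] by simp
  qed
  then show thesis using that by blast
qed

lemma occurrence_in_extend: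
  assumes hv: "h v = a @ v # b" "proj v a = []" "proj v b = []"
    and w: "set w \<inter> above v \<subseteq> {v}" and fw: "f w = x @ v # r"
  obtains w1 w2 where "w = w1 @ v # w2" "x = f w1 @ a" "r = b @ f w2"
proof -
  have "v \<in> above v"
    using self by (simp add: above_def)
  then have nab: "v \<notin> set a" "v \<notin> set b"
    using hv by (auto simp: filter_empty_conv)
  have "\<exists>w1 w2. w = w1 @ v # w2 \<and> x = f w1 @ a \<and> r = b @ f w2"
    using w fw
  proof (induction w arbitrary: x)
    case (Cons y w)
    from Cons.prems(2) have eq: "h y @ f w = x @ v # r"
      by (simp add: extend_Cons)
    show ?case
    proof (cases "y = v \<and> length x \<le> length a")
      case True
      then have "a @ v # (b @ f w) = x @ v # r"
        using eq hv by simp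
      then have "x = a" "r = b @ f w"
        using True nab by (auto simp: append_eq_append_conv2 append_eq_Cons_conv Cons_eq_append_conv)
      then show ?thesis
        using True by (intro exI[of _ "[]"] exI[of _ w]) auto
    next
      case False
      have "length (h y) \<le> length x"
      proof (rule ccontr)
        assume "\<not> ?thesis"
        then obtain t where t: "h y = x @ v # t"
          using eq by (auto simp: append_eq_append_conv2 append_eq_Cons_conv Cons_eq_append_conv)
        then have "y = v"
          using Cons.prems(1) by (auto simp: above_def)
        then have "x = a"
          using t hv nab by (auto simp: append_eq_append_conv2 append_eq_Cons_conv Cons_eq_append_conv)
        then show False
          using False \<open>y = v\<close> by simp
      qed
      then obtain x' where "x = h y @ x'" "f w = x' @ v # r"
        using eq by (auto simp: append_eq_append_conv2 append_eq_Cons_conv Cons_eq_append_conv)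
      moreover from this obtain w1 w2 where "w = w1 @ v # w2" "x' = f w1 @ a" "r = b @ f w2"
        using Cons.IH[of x'] Cons.prems(1) by auto
      ultimately show ?thesis
        by (intro exI[of _ "y # w1"] exI[of _ w2]) (auto simp: extend_Cons)
    qed
  qed simp
  then show thesis using that by blast
qed

lemma gap_funpow:
  assumes hv: "h v = a @ v # b" "proj v a = []" "proj v b = []" and nonconst: "h v \<noteq> [v]"
    and w: "set w \<inter> above v \<subseteq> {v}" and fw: "(f ^^ t) w = x @ v # y @ v # z"
  shows "t \<le> length y"
  using fw
proof (induction t arbitrary: x y z)
  case (Suc t)
  have cls: "set (h v) \<inter> above v \<subseteq> {v}"
    using hv by (auto simp: filter_empty_conv)
  then have "tame v w"
    using w hv by (auto simp: tame_def)
  then have t: "set ((f ^^ t) w) \<inter> above v \<subseteq> {v}"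
    using tame_funpow[of v w t] cls by (auto simp: tame_def)
  have "v \<in> above v"
    using self by (simp add: above_def)
  then have nab: "v \<notin> set b"
    using hv by (auto simp: filter_empty_conv)
  have "f ((f ^^ t) w) = x @ v # (y @ v # z)"
    using Suc.prems by simp
  then obtain w1 w2 where 1: "(f ^^ t) w = w1 @ v # w2" "y @ v # z = b @ f w2"
    using occurrence_in_extend[OF hv t] by metis
  from 1(2) nab obtain y' where y: "y = b @ y'" "f w2 = y' @ v # z"
    by (auto simp: append_eq_append_conv2 append_eq_Cons_conv Cons_eq_append_conv)
  have "set w2 \<inter> above v \<subseteq> {v}"
    using t 1 by auto
  then obtain w3 w4 where 2: "w2 = w3 @ v # w4" "y' = f w3 @ a"
    using y(2) occurrence_in_extend[OF hv] by metis
  have "t \<le> length w3"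
    using Suc.IH 1(1) 2(1) by simp
  moreover have "length a + length b > 0"
    using nonconst hv(1) by auto
  ultimately show ?case
    using y(1) 2(2) length_extend_ge[of w3] by (simp only: length_append)
qed simp

lemma non_expanding_bound:
  assumes hv: "h v = a @ v # b" "proj v a = []" "proj v b = []" and nonconst: "h v \<noteq> [v]"
  obtains T where "\<And>u w k c p q. tame v w \<Longrightarrow> (f ^^ T) u = c @ p \<Longrightarrow> (f ^^ T) w = c @ q \<Longrightarrow>
    diverge p q \<Longrightarrow> cleared (above v) k p q \<Longrightarrow> length (proj v q) \<le> 1"
proof -
  have vv: "v \<in> above v"
    using self by (simp add: above_def)
  have cls: "set (h v) \<inter> above v \<subseteq> {v}"
    using hv by (auto simp: filter_empty_conv)
  obtain S0 where S0: "\<And>u w k. tame v w \<Longrightarrow> length (proj v w) \<le> 2 \<Longrightarrow>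
      cleared (above v) k u w \<Longrightarrow> cleared (above v) S0 u w"
    using cleared_uniform_of_bounded[of v 2] by blast
  define S where "S = Suc S0"
  have S: "cleared (above v) S u w"
    if "tame v w" "length (proj v w) \<le> 2" "cleared (above v) k u w" for u w k
    using S0[OF that] by (rule cleared_mono[OF inert_above]) (simp add: S_def)
  define T where "T = Suc (Max (range (\<lambda>x. length ((f ^^ S) [x]))))"
  have T: "length ((f ^^ S) [x]) < T" for x
    unfolding T_def by (rule le_imp_less_Suc, rule Max_ge) auto
  have "length (proj v q) \<le> 1"
    if w: "tame v w" and u: "(f ^^ T) u = c @ p" and fw: "(f ^^ T) w = c @ q"
      and div: "diverge p q" and cl: "cleared (above v) k p q" for u w k c p q
  proof (rule ccontr)
    assume "\<not> ?thesis"
    then obtain x1 x2 xs where q12: "proj v q = x1 # x2 # xs"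
      by (cases "proj v q"; cases "tl (proj v q)") auto
    have tq: "tame v q"
      using tame_funpow[OF w, of T] fw by (simp add: tame_append)
    then have qv: "set q \<inter> above v \<subseteq> {v}"
      using cls by (auto simp: tame_def)
    then have "set (proj v q) \<subseteq> {v}" by auto
    then have x12: "x1 = v" "x2 = v"
      using q12 by auto
    obtain q0 q' where q1: "q = q0 @ v # q'" "proj v q0 = []" "proj v q' = v # xs"
      using q12 x12 by (metis split_first)
    obtain q2 q3 where q2: "q' = q2 @ v # q3" "proj v q2 = []"
      using q1(3) by (metis split_first)
    define r where "r = q0 @ v # q2 @ [v]"
    have q: "q = r @ q3"
      by (simp add: r_def q1 q2)
    have r: "proj v r = [v, v]"
      using vv q1(2) q2(2) by (simp add: r_def)
    have tr: "tame v r"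
      using tq q by (simp add: tame_append)
    have clS: "cleared (above v) S p r"
      using S[OF tr, of k p] cleared_appendD cl r q by simp
    have fr: "proj v ((f ^^ S) r) = [v, v]"
    proof -
      have "extend (\<lambda>x. proj v (h x)) [v, v] = [v, v]"
        using hv vv by (simp add: extend_Cons)
      then have "(extend (\<lambda>x. proj v (h x)) ^^ k) [v, v] = [v, v]" for k
        by (induction k) simp_all
      then show ?thesis
        by (simp add: proj_funpow r)
    qed
    have "proj v p \<noteq> []"
    proof
      assume "proj v p = []"
      then have "proj v ((f ^^ S) p) = []"
        by (simp add: proj_funpow)
      then show False
        using cleared_prefix[OF clS] fr by simp
    qed
    then obtain y ys where "proj v p = y # ys"
      by (cases "proj v p") auto
    then obtain p0 p1 where p: "p = p0 @ y # p1" "proj v p0 = []" "y \<in> above v"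
      by (rule split_first)
    have "y \<noteq> v"
    proof
      assume "y = v"
      have "cleared (above v) S p (q0 @ [v])"
        using clS cleared_appendD[of "above v" S p "q0 @ [v]" "q2 @ [v]"] by (simp add: r_def)
      then have "cleared (above v) 0 p (q0 @ [v])"
        using sync[OF inert_above] p vv q1(2) \<open>y = v\<close> by simp
      then obtain d p' q' where d: "p = d @ p'" "q0 @ [v] = d @ q'" "set q' \<inter> above v = {}"
        by (auto simp: cleared_def)
      have "d \<noteq> []"
        using d vv by auto
      moreover have "q = d @ q' @ q2 @ v # q3"
        using q1(1) q2(1) d(2) by (metis append.assoc append_Cons append_Nil)
      ultimately show False
        using div d(1) by (cases d) (auto simp: diverge_def)
    qed
    have "2 \<le> length (proj v ((f ^^ S) [y]))"
    proof -
      have "y \<in> set (h y)" "v \<in> set (h y)"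
        using self p(3) by (auto simp: above_def)
      then have "{y, v} \<subseteq> set (f [y])"
        by (simp add: extend_Cons)
      also have "\<dots> \<subseteq> set ((f ^^ S) [y])"
        unfolding S_def funpow_Suc_right comp_def by (rule set_subset_funpow)
      finally have "{y, v} \<subseteq> set (proj v ((f ^^ S) [y]))"
        using p(3) vv by auto
      then have "card {y, v} \<le> card (set (proj v ((f ^^ S) [y])))"
        by (intro card_mono) auto
      then show ?thesis
        using \<open>y \<noteq> v\<close> card_length[of "proj v ((f ^^ S) [y])"] by simp
    qed
    then obtain y1 y2 zs where y12: "proj v ((f ^^ S) [y]) = y1 # y2 # zs"
      by (cases "proj v ((f ^^ S) [y])"; cases "tl (proj v ((f ^^ S) [y]))") auto
    have p_eq: "(f ^^ S) p = (f ^^ S) p0 @ (f ^^ S) [y] @ (f ^^ S) p1"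
      by (simp add: p(1) funpow_extend_Cons[of S h y p1])
    have p0: "proj v ((f ^^ S) p0) = []"
      using p(2) by (simp add: proj_funpow)
    have "prefix [v, v] ([y1, y2] @ zs @ proj v ((f ^^ S) p1))"
      using cleared_prefix[OF clS] unfolding fr p_eq filter_append y12 p0 by auto
    then have "y1 = v" "y2 = v" by auto
    obtain m0 m' where m1: "(f ^^ S) [y] = m0 @ v # m'" "proj v m0 = []" "proj v m' = v # zs"
      using y12 \<open>y1 = v\<close> \<open>y2 = v\<close> by (metis split_first)
    obtain m2 m3 where m2: "m' = m2 @ v # m3" "proj v m2 = []"
      using m1(3) by (metis split_first)
    define m where "m = (f ^^ S) p0 @ m0 @ v # m2 @ [v]"
    have m: "(f ^^ S) p = m @ m3 @ (f ^^ S) p1" "proj v m = [v, v]"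
      using p_eq m1 m2 p0 vv by (simp_all add: m_def)
    obtain d p' q' where d: "(f ^^ S) p = d @ p'" "(f ^^ S) r = d @ q'" "set q' \<inter> above v = {}"
      using clS by (auto simp: cleared_def)
    have "proj v q' = []"
      using d(3) by (auto simp: filter_empty_conv)
    then have dv: "proj v d = [v, v]"
      using fr d(2) by simp
    have "prefix m d"
    proof -
      have "prefix m ((f ^^ S) p)"
        by (simp add: m(1))
      moreover have "prefix d ((f ^^ S) p)"
        by (simp add: d(1))
      ultimately have "prefix m d \<or> prefix d m"
        using prefix_same_cases by blast
      then show ?thesis
      proof
        assume "prefix d m"
        then obtain e where e: "m = d @ e" by (auto simp: prefix_def)
        show ?thesis
        proof (cases e rule: rev_cases)
          case Nil
          then show ?thesis using e by simp
        next
          case (snoc e' z)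
          then have "m = (d @ e') @ [z]"
            using e by simp
          moreover have "m = ((f ^^ S) p0 @ m0 @ v # m2) @ [v]"
            by (simp add: m_def)
          ultimately have "d @ e' = (f ^^ S) p0 @ m0 @ v # m2"
            by (metis append1_eq_conv)
          then have "proj v (d @ e') = proj v ((f ^^ S) p0 @ m0 @ v # m2)"
            by (rule arg_cong)
          then have "proj v d @ proj v e' = [v]"
            using m1(2) m2(2) p0 vv by simp
          then show ?thesis using dv by simp
        qed
      qed
    qed
    then obtain d' where "d = m @ d'" by (auto simp: prefix_def)
    have "(f ^^ (S + T)) w = (f ^^ S) c @ (m @ d') @ q' @ (f ^^ S) q3"
      using \<open>d = m @ d'\<close> d(2) q fw by (simp add: funpow_add)
    then have "(f ^^ (S + T)) w =
        ((f ^^ S) c @ (f ^^ S) p0 @ m0) @ v # m2 @ v # (d' @ q' @ (f ^^ S) q3)"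
      by (simp add: m_def)
    moreover have "set w \<inter> above v \<subseteq> {v}"
      using w cls by (auto simp: tame_def)
    ultimately have "S + T \<le> length m2"
      using gap_funpow[OF hv nonconst] by blast
    moreover have "length m2 \<le> length ((f ^^ S) [y])"
      using m1 m2 by simp
    ultimately show False
      using T[of y] by simp
  qed
  then show thesis using that by blast
qed

lemma class_uniform:
  assumes nonconst: "h v \<noteq> [v]"
  obtains T where "\<And>u w k. tame v w \<Longrightarrow> cleared (above v) k u w \<Longrightarrow> cleared (above v) T u w"
proof (cases "\<forall>y. y \<in> set (h v) \<longrightarrow> y \<in> above v \<longrightarrow> 2 \<le> length (proj v (h y))")
  case True
  obtain B where B: "\<And>u w k. diverge u w \<Longrightarrow> tame v w \<Longrightarrow> cleared (above v) k u w \<Longrightarrow>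
      length (proj v w) \<le> B"
    using expanding_bound[of v] True by blast
  obtain S where S: "\<And>u w k. tame v w \<Longrightarrow> length (proj v w) \<le> B \<Longrightarrow>
      cleared (above v) k u w \<Longrightarrow> cleared (above v) S u w"
    using cleared_uniform_of_bounded[of v B] by blast
  have "cleared (above v) S u w" if "tame v w" "cleared (above v) k u w" for u w k
  proof -
    obtain c u' w' where c: "u = c @ u'" "w = c @ w'" "diverge u' w'"
      by (rule diverge_decomposition)
    then have "cleared (above v) k u' w'" "tame v w'"
      using that by (simp_all add: cleared_cancel tame_append)
    then show ?thesis
      using S B c by (simp add: cleared_cancel)
  qed
  then show thesis using that by blast
next
  case False
  then obtain y where y: "y \<in> set (h v)" "v \<in> set (h y)" "length (proj v (h y)) < 2"
    by (auto simp: above_def not_le)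
  have "v \<in> above v"
    using self by (simp add: above_def)
  have "y \<in> set (proj v (h y))" "v \<in> set (proj v (h y))"
    using self y \<open>v \<in> above v\<close> by (auto simp: above_def)
  then have "y = v" "proj v (h v) = [v]"
    using y(3) by (cases "proj v (h y)"; auto)+
  then obtain a b where hv: "h v = a @ v # b" "proj v a = []" "proj v b = []"
    by (metis split_first)
  obtain T where T: "\<And>u w k c p q. tame v w \<Longrightarrow> (f ^^ T) u = c @ p \<Longrightarrow> (f ^^ T) w = c @ q \<Longrightarrow>
      diverge p q \<Longrightarrow> cleared (above v) k p q \<Longrightarrow> length (proj v q) \<le> 1"
    using non_expanding_bound[OF hv nonconst] by blast
  obtain S where S: "\<And>u w k. tame v w \<Longrightarrow> length (proj v w) \<le> 1 \<Longrightarrow>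
      cleared (above v) k u w \<Longrightarrow> cleared (above v) S u w"
    using cleared_uniform_of_bounded[of v 1] by blast
  have "cleared (above v) (S + T) u w" if w: "tame v w" and cl: "cleared (above v) k u w" for u w k
  proof -
    obtain c p q where c: "(f ^^ T) u = c @ p" "(f ^^ T) w = c @ q" "diverge p q"
      by (rule diverge_decomposition)
    have "cleared (above v) (k + T) u w"
      using cl by (rule cleared_mono[OF inert_above]) simp
    then have "cleared (above v) k p q"
      by (simp add: cleared_add c cleared_cancel)
    moreover have "tame v q"
      using tame_funpow[OF w, of T] c by (simp add: tame_append)
    ultimately have "cleared (above v) S p q"
      using S T[OF w c] by blast
    then show ?thesis
      by (simp add: cleared_add c cleared_cancel)
  qed
  then show thesis using that by blast
qed

section \<open>Clearing all nonconstant letters\<close>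

definition nonconst :: "'a set" where
  "nonconst = {x. h x \<noteq> [x]}"

lemma inert_nonconst: "inert nonconst"
  by (auto simp: inert_def nonconst_def)

lemma maximal_letter:
  assumes "x \<in> D" "x \<in> nonconst"
  obtains v where "v \<in> D" "v \<in> nonconst" "D \<inter> above v \<subseteq> set (h v)"
proof -
  define m where "m y = card (set (h y))" for y
  define M where "M = Max (m ` (D \<inter> nonconst))"
  have "D \<inter> nonconst \<noteq> {}"
    using assms by blast
  then have "M \<in> m ` (D \<inter> nonconst)"
    unfolding M_def by (intro Max_in) simp_all
  then obtain v where "v \<in> D \<inter> nonconst" "M = m v"
    by (rule imageE)
  then have v: "v \<in> D" "v \<in> nonconst" "m v = M"
    by simp_all
  have "D \<inter> above v \<subseteq> set (h v)"
  proof
    fix y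
    assume y: "y \<in> D \<inter> above v"
    then have sub: "set (h v) \<subseteq> set (h y)"
      using trans[of v y] by (auto simp: above_def)
    have "y \<in> nonconst"
      using y v(2) by (auto simp: nonconst_def above_def)
    then have "m y \<le> m v"
      unfolding v(3) M_def using y by (intro Max_ge) auto
    then have "set (h v) = set (h y)"
      using sub by (intro card_seteq) (auto simp: m_def)
    then show "y \<in> set (h v)"
      using self by auto
  qed
  then show thesis using that v by blast
qed

lemma cleared_nonconst_uniform_on:
  assumes "\<And>x. x \<in> D \<Longrightarrow> set (h x) \<subseteq> D"
  shows "\<exists>T. \<forall>u w k. set w \<subseteq> D \<longrightarrow> cleared nonconst k u w \<longrightarrow> cleared nonconst T u w"
  using finite[of D] assms
proof (induction D rule: finite_psubset_induct)
  case (psubset D)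
  show ?case
  proof (cases "D \<inter> nonconst = {}")
    case True
    then have "cleared nonconst 0 u w" if "set w \<subseteq> D" for u w
      using that by (intro cleared_trivial) auto
    then show ?thesis by blast
  next
    case False
    then obtain v where v: "v \<in> D" "v \<in> nonconst" "D \<inter> above v \<subseteq> set (h v)"
      using maximal_letter[of _ D] by blast
    have "v \<in> above v"
      using self by (simp add: above_def)
    have sub: "above v \<subseteq> nonconst"
      using v(2) by (auto simp: above_def nonconst_def)
    obtain S where S: "\<And>u w k. tame v w \<Longrightarrow> cleared (above v) k u w \<Longrightarrow> cleared (above v) S u w"
      using class_uniform v(2) by (auto simp: nonconst_def)
    have "D - above v \<subset> D"
      using v(1) \<open>v \<in> above v\<close> by auto
    moreover have "set (h x) \<subseteq> D - above v" if "x \<in> D - above v" for x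
      using psubset.prems[of x] inert_above[of v] that by (auto simp: inert_def)
    ultimately obtain T where T: "\<And>u w k. set w \<subseteq> D - above v \<Longrightarrow> cleared nonconst k u w \<Longrightarrow>
        cleared nonconst T u w"
      using psubset.IH[of "D - above v"] by blast
    have "cleared nonconst (T + S) u w" if w: "set w \<subseteq> D" and cl: "cleared nonconst k u w" for u w k
    proof -
      have "tame v w"
        using w v(3) by (auto simp: tame_def)
      moreover have "cleared (above v) k u w"
        using cl sub by (fastforce simp: cleared_def)
      ultimately have "cleared (above v) S u w"
        by (rule S)
      then obtain c p q where c: "(f ^^ S) u = c @ p" "(f ^^ S) w = c @ q" "set q \<inter> above v = {}"
        by (auto simp: cleared_def)
      have "set ((f ^^ S) w) \<subseteq> D"
        using w psubset.prems by (induction S) (auto simp: set_extend)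
      then have "set q \<subseteq> D - above v"
        using c by auto
      moreover have "cleared nonconst (k + S) u w"
        using cl by (rule cleared_mono[OF inert_nonconst]) simp
      then have "cleared nonconst k p q"
        by (simp add: cleared_add c cleared_cancel)
      ultimately have "cleared nonconst T p q"
        by (rule T)
      then show ?thesis
        by (simp add: cleared_add c cleared_cancel)
    qed
    then show ?thesis by blast
  qed
qed

lemma cleared_nonconst_uniform:
  "\<exists>T. \<forall>u w k. cleared nonconst k u w \<longrightarrow> cleared nonconst T u w"
  using cleared_nonconst_uniform_on[of UNIV] by simp

end

section \<open>Quotients of positive words\<close>

definition pos :: "'a list \<Rightarrow> 'a word" where
  "pos w = map (\<lambda>x. (x, True)) w"

definition neg :: "'a list \<Rightarrow> 'a word" where
  "neg w = map (\<lambda>x. (x, False)) w"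

text \<open>Words are read backwards, so that the cancellation in \<open>U V\<^sup>-\<^sup>1\<close> happens at a common prefix.\<close>

definition quot :: "'a list \<Rightarrow> 'a list \<Rightarrow> 'a word" where
  "quot u w = pos (rev u) \<otimes>\<^bsub>free_group\<^esub> inv\<^bsub>free_group\<^esub> (pos (rev w))"

lemma pos_Nil [simp]: "pos [] = []"
  and pos_append [simp]: "pos (u @ w) = pos u @ pos w"
  and pos_eq_iff [simp]: "pos u = pos w \<longleftrightarrow> u = w"
  and pos_singleton: "pos [x] = gen x"
  by (auto simp: pos_def gen_def inj_map_eq_map inj_def)

lemma neg_append [simp]: "neg (u @ w) = neg u @ neg w"
  by (simp add: neg_def)

lemma positive_word_pos: "positive_word (pos w)"
  by (auto simp: positive_word_def pos_def)

lemma positive_word_eq_pos: "positive_word w \<Longrightarrow> w = pos (map fst w)"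
  by (auto simp: positive_word_def pos_def prod_eq_iff intro!: nth_equalityI)

lemma pos_carrier [simp]: "pos w \<in> carrier free_group"
  using positive_word_in_free_group positive_word_pos by blast

lemma reduced_pos: "reduced (pos w)"
  using pos_carrier[of w] unfolding free_group_def by simp

lemma mult_pos: "pos u \<otimes>\<^bsub>free_group\<^esub> pos w = pos (u @ w)"
  using reduce_reduced[OF reduced_pos[of "u @ w"]] by (simp add: free_group_def)

lemma inv_pos: "inv\<^bsub>free_group\<^esub> (pos (rev w)) = reduce (neg w)"
proof -
  interpret group free_group
    by (rule group_free_group)
  have "rev (map flip (pos (rev w))) = neg w"
    by (simp add: pos_def neg_def rev_map flip_def comp_def)
  then have "reduce (neg w) \<otimes>\<^bsub>free_group\<^esub> pos (rev w) = \<one>\<^bsub>free_group\<^esub>"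
    using reduce_inverse[of "pos (rev w)"] by (simp add: free_group_def reduce_append_left)
  moreover have "reduce (neg w) \<in> carrier free_group"
    by (simp add: free_group_def reduced_reduce)
  ultimately show ?thesis
    by (intro inv_equality) simp_all
qed

lemma quot_eq: "quot u w = reduce (pos (rev u) @ neg w)"
  unfolding quot_def inv_pos by (simp add: free_group_def reduce_append_right)

lemma quot_cancel: "quot (c @ u) (c @ w) = quot u w"
proof -
  have "rev (map flip (neg c)) = pos (rev c)"
    by (simp add: pos_def neg_def rev_map flip_def comp_def)
  then have "reduce (pos (rev c) @ neg c) = []"
    using reduce_inverse[of "neg c"] by simp
  then have "reduce (pos (rev c) @ neg c @ neg w) = reduce (neg w)"
    using reduce_append_left[of "pos (rev c) @ neg c" "neg w"] by simp
  then have "reduce (pos (rev u) @ pos (rev c) @ neg c @ neg w) = reduce (pos (rev u) @ neg w)"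
    by (metis reduce_append_right)
  then show ?thesis
    by (simp add: quot_eq)
qed

lemma quot_diverge:
  assumes "diverge u w"
  shows "quot u w = pos (rev u) @ neg w"
proof -
  have "successively (\<lambda>k l. l \<noteq> flip k) (neg w)"
    unfolding neg_def successively_map by (induction w rule: induct_list012) (auto simp: flip_def)
  moreover have "last (pos (rev u)) = (hd u, True)" if "u \<noteq> []"
    using that by (simp add: pos_def last_map last_rev)
  moreover have "hd (neg w) = (hd w, False)" if "w \<noteq> []"
    using that by (simp add: neg_def hd_map)
  ultimately have "reduced (pos (rev u) @ neg w)"
    using assms reduced_pos[of "rev u"]
    by (auto simp: reduced_def successively_append_iff diverge_def flip_def pos_def neg_def)
  then show ?thesis
    by (simp add: quot_eq reduce_reduced)
qed

lemma set_reduce: "set (reduce w) \<subseteq> set w"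
proof (induction w)
  case (Cons l w)
  have "set (push l v) \<subseteq> insert l (set v)" for v
    by (cases v) auto
  from this[of "reduce w"] Cons show ?case
    unfolding reduce_def by (simp only: foldr.simps comp_apply list.set) blast
qed (simp add: reduce_def)

lemma negative_letters_quot:
  "(x, False) \<in> set (quot u w) \<Longrightarrow> x \<in> set w"
  using set_reduce[of "pos (rev u) @ neg w"] by (auto simp: quot_eq pos_def neg_def)

lemma negative_letters_quot_diverge:
  "diverge u w \<Longrightarrow> (x, False) \<in> set (quot u w) \<longleftrightarrow> x \<in> set w"
  by (auto simp: quot_diverge pos_def neg_def)

section \<open>Positive monomorphisms\<close>

locale positive_monomorphism = group_hom free_group free_group \<phi>
  for \<phi> :: "'a::finite word \<Rightarrow> 'a word" +
  assumes inj_on_carrier: "inj_on \<phi> (carrier free_group)"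
    and positive: "positive \<phi>"
begin

definition h :: "'a \<Rightarrow> 'a list" where
  "h x = rev (map fst (\<phi> (gen x)))"

lemma apply_gen: "\<phi> (pos [x]) = pos (rev (h x))"
  unfolding pos_singleton using positive positive_word_eq_pos[of "\<phi> (gen x)"] by (simp add: positive_def h_def)

lemma apply_pos: "\<phi> (pos (rev w)) = pos (rev (extend h w))"
proof (induction w)
  case Nil
  show ?case
    using hom_one by (simp add: free_group_def)
next
  case (Cons x w)
  have "pos (rev (x # w)) = pos (rev w) \<otimes>\<^bsub>free_group\<^esub> pos [x]"
    unfolding mult_pos by simp
  then have "\<phi> (pos (rev (x # w))) = \<phi> (pos (rev w)) \<otimes>\<^bsub>free_group\<^esub> \<phi> (pos [x])"
    by (simp only: hom_mult pos_carrier)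
  then show ?case
    unfolding Cons apply_gen mult_pos by (simp add: extend_Cons)
qed

lemma funpow_pos: "(\<phi> ^^ k) (pos (rev w)) = pos (rev ((extend h ^^ k) w))"
  by (induction k) (simp_all add: apply_pos)

lemma apply_quot: "\<phi> (quot u w) = quot (extend h u) (extend h w)"
  by (simp add: quot_def apply_pos)

lemma funpow_quot: "(\<phi> ^^ k) (quot u w) = quot ((extend h ^^ k) u) ((extend h ^^ k) w)"
  by (induction k) (simp_all add: apply_quot)

lemma inj_extend: "inj (extend h)"
proof (rule injI)
  fix u w
  assume "extend h u = extend h w"
  then have "\<phi> (pos (rev u)) = \<phi> (pos (rev w))"
    by (simp add: apply_pos)
  then have "pos (rev u) = pos (rev w)"
    using inj_on_carrier by (auto dest: inj_onD)
  then show "u = w"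
    by simp
qed

lemma prefix_extend:
  assumes "\<And>x. length (h x) \<le> K" "prefix c (extend h u)"
  obtains v r where "prefix v u" "c = extend h v @ r" "length r \<le> K"
proof -
  have "\<exists>v r. prefix v u \<and> c = extend h v @ r \<and> length r \<le> K"
    using assms(2)
  proof (induction u arbitrary: c)
    case (Cons x u)
    then consider "prefix c (h x)" | d where "c = h x @ d" "prefix d (extend h u)"
      by (auto simp: extend_Cons prefix_append)
    then show ?case
    proof cases
      case 1
      then have "length c \<le> K"
        using assms(1)[of x] prefix_length_le le_trans by blast
      then show ?thesis
        by (intro exI[of _ "[]"] exI[of _ c]) simp
    next
      case 2
      then obtain v r where "prefix v u" "d = extend h v @ r" "length r \<le> K"
        using Cons.IH by blast
      then show ?thesis
        using 2 by (intro exI[of _ "x # v"] exI[of _ r]) (simp add: extend_Cons)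
    qed
  qed simp
  then show thesis using that by blast
qed

text \<open>If \<open>extend h v @ r = extend h v' @ s\<close>, the quotient of \<open>v\<close> and \<open>v'\<close> is determined
  by the pair \<open>(r, s)\<close>, because \<open>\<phi>\<close> is injective; and only finitely many short pairs exist.\<close>

lemma bounded_cancellation:
  "\<exists>B. \<forall>u w c. diverge u w \<longrightarrow> prefix c (extend h u) \<longrightarrow> prefix c (extend h w) \<longrightarrow> length c \<le> B"
proof -
  define K where "K = Max (range (\<lambda>x. length (h x)))"
  have K: "length (h x) \<le> K" for x
    unfolding K_def by (rule Max_ge) auto
  define A where "A = {r :: 'a list. set r \<subseteq> UNIV \<and> length r \<le> K}"
  define E where "E = (\<lambda>(r, s). inv\<^bsub>free_group\<^esub> (pos (rev r)) \<otimes>\<^bsub>free_group\<^esub> pos (rev s)) ` (A \<times> A)"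
  define P where "P = \<phi> -` E \<inter> carrier free_group"
  have "finite A"
    unfolding A_def by (rule finite_lists_length_le) simp
  then have "finite E"
    unfolding E_def by simp
  then have "finite P"
    unfolding P_def using inj_on_carrier by (rule finite_vimage_IntI)
  define L where "L = Max (length ` P)"
  have "length c \<le> K * L + K"
    if div: "diverge u w" and c: "prefix c (extend h u)" "prefix c (extend h w)" for u w c
  proof -
    obtain v r where v: "prefix v u" "c = extend h v @ r" "length r \<le> K"
      using K c(1) by (rule prefix_extend)
    obtain v' s where v': "prefix v' w" "c = extend h v' @ s" "length s \<le> K"
      using K c(2) by (rule prefix_extend)
    have "diverge v v'"
      using div v(1) v'(1) by (auto simp: diverge_def prefix_def)
    have "pos (rev r) \<otimes>\<^bsub>free_group\<^esub> \<phi> (pos (rev v)) = pos (rev s) \<otimes>\<^bsub>free_group\<^esub> \<phi> (pos (rev v'))"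
      using v(2) v'(2) unfolding apply_pos mult_pos by (simp flip: rev_append)
    then have "\<phi> (pos (rev v)) =
        inv\<^bsub>free_group\<^esub> (pos (rev r)) \<otimes>\<^bsub>free_group\<^esub> (pos (rev s) \<otimes>\<^bsub>free_group\<^esub> \<phi> (pos (rev v')))"
      by (intro G.inv_solve_left[THEN iffD2]) simp_all
    then have "\<phi> (quot v v') = inv\<^bsub>free_group\<^esub> (pos (rev r)) \<otimes>\<^bsub>free_group\<^esub> pos (rev s)"
      by (simp add: quot_def G.m_assoc)
    then have "quot v v' \<in> P"
      using v(3) v'(3) by (auto simp: P_def E_def A_def quot_def)
    then have "length (quot v v') \<le> L"
      unfolding L_def using \<open>finite P\<close> by (intro Max_ge) auto
    then have "length v \<le> L"
      using \<open>diverge v v'\<close> by (simp add: quot_diverge pos_def)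
    have "length (extend h v) \<le> K * length v"
      using K by (induction v) (auto simp: extend_Cons intro: add_mono)
    also have "\<dots> \<le> K * L"
      using \<open>length v \<le> L\<close> by simp
    finally show ?thesis
      using v by simp
  qed
  then show ?thesis by blast
qed

lemma constant_letter_iff: "constant_letter \<phi> x \<longleftrightarrow> h x = [x]"
  using apply_gen[of x] by (simp add: constant_letter_def rev_swap flip: pos_singleton)

lemma substitution_h:
  assumes "conditioned \<phi>"
  shows "substitution h"
proof
  have letters_pos: "letters (pos (rev w)) = set w" for w :: "'a list"
    by (force simp: letters_def pos_def)
  have letters_gen: "letters ((\<phi> ^^ j) (gen x)) = set ((extend h ^^ j) [x])" for j x
    using funpow_pos[of j "[x]"] letters_pos by (simp add: pos_singleton)
  have letters_h: "letters (\<phi> (gen x)) = set (h x)" for x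
    using apply_gen[of x] by (simp add: letters_pos pos_singleton)
  have cond: "(\<forall>x. x \<in> letters (\<phi> (gen x))) \<and>
      (\<forall>x. \<forall>y\<in>Supp \<phi> x. y \<in> letters (\<phi> (gen x)))"
    using assms unfolding conditioned_def by (elim conjE, intro conjI)
  show "x \<in> set (h x)" for x
    using cond letters_h by blast
  show "z \<in> set (h x)" if "y \<in> set (h x)" "z \<in> set (h y)" for x y z
  proof -
    have "z \<in> set ((extend h ^^ 2) [x])"
      using that by (auto simp: numeral_2_eq_2 set_extend)
    then have "z \<in> Supp \<phi> x"
      unfolding Supp_def letters_gen by blast
    then show ?thesis
      using cond letters_h by blast
  qed
qed (fact inj_extend bounded_cancellation)+

lemma neuters_within_iff:
  assumes "conditioned \<phi>"
  shows "neuters_within \<phi> (pos (rev u)) (pos (rev w)) k \<longleftrightarrow>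
    k > 0 \<and> substitution.cleared h (substitution.nonconst h) k u w"
proof -
  interpret substitution h
    using assms by (rule substitution_h)
  obtain c p q where c: "(f ^^ k) u = c @ p" "(f ^^ k) w = c @ q" "diverge p q"
    by (rule diverge_decomposition)
  have eq: "(\<phi> ^^ k) (quot u w) = quot p q"
    unfolding funpow_quot c quot_cancel ..
  have "(\<forall>x. (x, False) \<in> set (quot p q) \<longrightarrow> constant_letter \<phi> x) \<longleftrightarrow> cleared nonconst k u w"
  proof
    assume "\<forall>x. (x, False) \<in> set (quot p q) \<longrightarrow> constant_letter \<phi> x"
    then have "set q \<inter> nonconst = {}"
      using c(3) by (auto simp: negative_letters_quot_diverge constant_letter_iff nonconst_def)
    with c(1,2) show "cleared nonconst k u w"
      by (rule clearedI)
  next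
    assume "cleared nonconst k u w"
    then obtain d p' q' where d: "(f ^^ k) u = d @ p'" "(f ^^ k) w = d @ q'"
      "set q' \<inter> nonconst = {}"
      by (auto simp: cleared_def)
    have "quot p q = quot p' q'"
      using eq unfolding funpow_quot d quot_cancel ..
    then show "\<forall>x. (x, False) \<in> set (quot p q) \<longrightarrow> constant_letter \<phi> x"
      using d(3) negative_letters_quot[of _ p' q'] by (auto simp: constant_letter_iff nonconst_def)
  qed
  then show ?thesis
    unfolding neuters_within_def eq[unfolded quot_def[of u w]] by blast
qed

end

theorem proposition1p8p4:
  fixes \<phi> :: "'a::finite word \<Rightarrow> 'a word"
  assumes "\<phi> \<in> iso free_group free_group"
    and "positive \<phi>"
    and "conditioned \<phi>"
  shows "\<exists>T\<^sub>0. \<forall>U V. positive_word U \<longrightarrow> positive_word V \<longrightarrow>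
           neuters \<phi> U V \<longrightarrow> neuters_within \<phi> U V T\<^sub>0"
proof -
  interpret positive_monomorphism \<phi>
    using assms(1,2) group_free_group
    by (intro positive_monomorphism.intro positive_monomorphism_axioms.intro group_hom.intro
        group_hom_axioms.intro) (auto simp: iso_def bij_betw_def)
  interpret substitution h
    using assms(3) by (rule substitution_h)
  obtain T where T: "\<And>u w k. cleared nonconst k u w \<Longrightarrow> cleared nonconst T u w"
    using cleared_nonconst_uniform by blast
  have "neuters_within \<phi> U V (Suc T)"
    if U: "positive_word U" and V: "positive_word V" and "neuters \<phi> U V" for U V
  proof -
    obtain k where k: "neuters_within \<phi> U V k"
      using \<open>neuters \<phi> U V\<close> by (auto simp: neuters_def)
    obtain u w where uw: "U = pos (rev u)" "V = pos (rev w)"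
      using positive_word_eq_pos[OF U] positive_word_eq_pos[OF V] by (metis rev_rev_ident)
    have "cleared nonconst T u w"
      using k T unfolding uw neuters_within_iff[OF assms(3)] by blast
    then have "cleared nonconst (Suc T) u w"
      by (rule cleared_mono[OF inert_nonconst]) simp
    then show ?thesis
      unfolding uw neuters_within_iff[OF assms(3)] by simp
  qed
  then show ?thesis by blast
qed

end
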